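(* If $L$ is a $2$-dimensional right nilpotent right Leibniz algebra over $\mathbb C$, then $L$ is dextral symmetric.
   Context: A right Leibniz algebra over a field $F$ is an $F$-vector space $L$ with a bilinear bracket $[\,,]:L\times L\to L$ satisfying $[a,[b,c]]=[[a,b],c]-[[a,c],b]$ for all $a,b,c\in L$. Let $L^{<1>}=L$ and $L^{<n+1>}=[L^{<n>},L]$ (span of brackets); $L$ is right nilpotent if $L^{<k>}=0$ for some $k\in\mathbb N$. $L$ is dextral symmetric if for all $a,b,c\in L$, $[a,[b,c]]=0$ implies $[b,[a,c]]=0$. *)

theory Defs
  imports Complex_Main
begin

locale right_leibniz_algebra = vector_space scale
  for scale :: "'f::field \<Rightarrow> 'a::ab_group_add \<Rightarrow> 'a" (infixr \<open>*s\<close> 75) +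
  fixes bracket :: "'a \<Rightarrow> 'a \<Rightarrow> 'a"
  assumes linear_bracket_left: "Vector_Spaces.linear scale scale (\<lambda>a. bracket a b)"
    and linear_bracket_right: "Vector_Spaces.linear scale scale (\<lambda>b. bracket a b)"
    and right_leibniz:
      "bracket a (bracket b c) = bracket (bracket a b) c - bracket (bracket a c) b"
begin

text \<open>The series is indexed from 1; the value at 0 is a dummy.\<close>

fun right_power :: "nat \<Rightarrow> 'a set" where
  "right_power 0 = UNIV"
| "right_power (Suc 0) = UNIV"
| "right_power (Suc (Suc n)) = span {bracket x y | x y. x \<in> right_power (Suc n)}"

definition right_nilpotent :: bool where
  "right_nilpotent \<longleftrightarrow> (\<exists>k\<ge>1. right_power k = {0})"

definition dextral_symmetric :: bool where
  "dextral_symmetric \<longleftrightarrow>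
    (\<forall>a b c. bracket a (bracket b c) = 0 \<longrightarrow> bracket b (bracket a c) = 0)"

end

end

(* In a finite-dimensional right nilpotent algebra the right central series strictly decreases
   until it reaches 0, because a repeated term would make it constant from there on. In
   dimension 2 the third term is therefore 0, so every [[x,y],z] vanishes, and the Leibniz
   identity then kills every [x,[y,z]] as well. *)
theory Submission
  imports Defs
begin

context right_leibniz_algebra
begin

lemma subspace_right_power: "subspace (right_power n)"
  by (cases n rule: right_power.cases) simp_all

(* As a rewrite rule this equation loops on an assumed equality of consecutive terms. *)
declare right_power.simps(3) [simp del]

lemma bracket_in_right_power:
  "x \<in> right_power (Suc n) \<Longrightarrow> bracket x y \<in> right_power (Suc (Suc n))"
  unfolding right_power.simps(3) by (intro span_base) blast

lemma right_power_Suc_subset: "right_power (Suc n) \<subseteq> right_power n"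
proof (induction n rule: right_power.induct)
  case (3 n)
  then show ?case
    unfolding right_power.simps(3)[of n] right_power.simps(3)[of "Suc n"]
    by (intro span_mono) blast
qed simp_all

text \<open>Each term is built from its predecessor alone, so one repetition propagates by
  induction.\<close>

lemma right_power_stationary:
  assumes "right_power (Suc (Suc n)) = right_power (Suc n)" "n \<le> m"
  shows "right_power (Suc m) = right_power (Suc n)"
  using assms(2)
proof (induction m rule: dec_induct)
  case (step m)
  then show ?case
    using assms(1) unfolding right_power.simps(3)[of m] right_power.simps(3)[of n] by simp
qed simp

lemma right_power_zero_antimono:
  assumes "right_power n = {0}" "n \<le> m"
  shows "right_power m = {0}"
proof -
  have "right_power m \<subseteq> right_power n"
    using right_power_Suc_subset assms(2) by (rule lift_Suc_antimono_le)
  then show ?thesis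
    using assms(1) subspace_0[OF subspace_right_power] by blast
qed

lemma right_power_Suc_psubset:
  assumes "right_nilpotent" "right_power (Suc n) \<noteq> {0}"
  shows "right_power (Suc (Suc n)) \<subset> right_power (Suc n)"
proof -
  obtain k where k: "right_power k = {0}"
    using assms(1) unfolding right_nilpotent_def by blast
  \<comment> \<open>This index lies beyond \<open>k\<close>, so the term is 0, and beyond
    \<open>n\<close>, so a repetition there would make the nonzero term
    \<open>right_power (Suc n)\<close> equal to it.\<close>
  have "right_power (Suc (max k n)) = {0}"
    using right_power_zero_antimono[OF k] by simp
  then have "right_power (Suc (Suc n)) \<noteq> right_power (Suc n)"
    using right_power_stationary[OF _ max.cobounded2] assms(2) by metis
  then show ?thesis
    using right_power_Suc_subset by blast
qed

(* The hypothesis 0 < dim UNIV is what gives finite dimension: dim is 0 for spaces of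
   infinite dimension. *)
lemma right_power_eq_zero_if_dim:
  assumes "right_nilpotent" "0 < dim UNIV"
  shows "right_power (Suc (dim UNIV)) = {0}"
proof -
  obtain B where B: "independent B" "UNIV \<subseteq> span B" "card B = dim UNIV"
    by (rule basis_exists[of UNIV])
  have "finite B"
    using B(3) assms(2) by (intro card_ge_0_finite) simp
  then interpret finite_dimensional_vector_space scale B
    using B by unfold_locales auto
  \<comment> \<open>Index 1 is the whole space, so term \<open>Suc n\<close> comes after
    \<open>n\<close> steps, each costing at least one dimension until 0 is reached.\<close>
  have bound: "right_power (Suc n) = {0} \<or> dim (right_power (Suc n)) + n \<le> dim UNIV" for n
  proof (induction n)
    case (Suc n)
    show ?case
    proof (cases "right_power (Suc n) = {0}")
      case True
      then show ?thesis
        using right_power_zero_antimono[OF True le_SucI[OF order_refl]] by simp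
    next
      case False
      \<comment> \<open>\<open>dim_psubset\<close> compares spans; each term, being a subspace, is
        its own span.\<close>
      then have "dim (right_power (Suc (Suc n))) < dim (right_power (Suc n))"
        using right_power_Suc_psubset[OF assms(1)]
        by (intro dim_psubset) (simp add: span_eq_iff[THEN iffD2, OF subspace_right_power])
      then show ?thesis
        using Suc.IH False by linarith
    qed
  qed simp
  \<comment> \<open>At \<open>n = dim UNIV\<close> the second alternative leaves dimension
    0.\<close>
  from bound[of "dim UNIV"] have "right_power (Suc (dim UNIV)) \<subseteq> {0}"
    using dim_eq_0 by auto
  then show ?thesis
    using subspace_0[OF subspace_right_power] by blast
qed

lemma dextral_symmetric_if_right_power_3:
  assumes "right_power 3 = {0}"
  shows "dextral_symmetric"
proof -
  have "bracket x y \<in> right_power (Suc (Suc 0))" for x y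
    by (rule bracket_in_right_power) simp
  then have "bracket (bracket x y) z \<in> right_power (Suc (Suc (Suc 0)))" for x y z
    by (rule bracket_in_right_power)
  then have "bracket (bracket x y) z = 0" for x y z
    using assms unfolding numeral_3_eq_3 by blast
  then show ?thesis
    unfolding dextral_symmetric_def by (simp add: right_leibniz)
qed

end

theorem proposition5p1:
  fixes scale :: "complex \<Rightarrow> 'a::ab_group_add \<Rightarrow> 'a"
    and bracket :: "'a \<Rightarrow> 'a \<Rightarrow> 'a"
  assumes "right_leibniz_algebra scale bracket"
    and "vector_space.dim scale (UNIV :: 'a set) = 2"
    and "right_leibniz_algebra.right_nilpotent scale bracket"
  shows "right_leibniz_algebra.dextral_symmetric bracket"
proof -
  interpret right_leibniz_algebra scale bracket
    by (rule assms(1))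
  \<comment> \<open>Dimension 2 gives index \<open>Suc 2\<close>, since the series is indexed from
    1.\<close>
  have "right_power 3 = {0}"
    using right_power_eq_zero_if_dim[OF assms(3)] assms(2) by simp
  then show ?thesis
    by (rule dextral_symmetric_if_right_power_3)
qed

end
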